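(* Let $X$ and $Y$ be independent absolutely continuous nonnegative random variables with CDFs $F$ and $G$, respectively, such that $F(t)>0$ and $G(t)>0$ for all $t>0$. Then the reversed relevation transform of $X$ and $Y$ is commutative, i.e. $G\widetilde{\#}F(x)=F\widetilde{\#}G(x)$ for all $x>0$, if and only if $X$ and $Y$ satisfy the proportional reversed hazards rate model, i.e. there is a constant $\theta>0$ such that $G(x)=[F(x)]^{\theta}$ for all $x>0$.
   Context: For CDFs $F,G$ of absolutely continuous nonnegative random variables, positive on $(0,\infty)$, the reversed relevation transform is $$G\widetilde{\#}F(x)=G(x)+F(x)\int_{x}^{\infty}\frac{1}{F(t)}\,{\rm d}G(t),\qquad x>0,$$ and $F\widetilde{\#}G(x)$ is obtained by exchanging the roles of $F$ and $G$. *)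

theory Defs
  imports "HOL-Probability.Probability"
begin

text \<open>
  The integral against \<open>dG\<close> is the Lebesgue--Stieltjes integral; \<^const>\<open>interval_measure\<close> is
  meaningful only when \<open>G\<close> is nondecreasing and right-continuous, as every CDF is. If moreover
  \<open>F\<close> is a CDF with \<open>F x > 0\<close>, the integrand is measurable and bounded by \<open>1 / F x\<close> on
  \<open>{x<..}\<close>, so the integral genuinely exists.
\<close>

definition reversed_relevation :: "(real \<Rightarrow> real) \<Rightarrow> (real \<Rightarrow> real) \<Rightarrow> real \<Rightarrow> real" where
  "reversed_relevation G F x = G x + F x * (LINT t:{x<..}|interval_measure G. 1 / F t)"

end

theory Submission
  imports Defs
begin

text \<open>
  Let \<open>A x\<close> and \<open>B x\<close> be the integrals of \<open>1 / F\<close> against \<open>dG\<close> and of \<open>1 / G\<close> against \<open>dF\<close> over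
  \<open>(x, \<infinity>)\<close>, so that \<open>dA = - dG / F\<close> and \<open>dB = - dF / G\<close>. Differentiating the commutativity
  relation \<open>G + F A = F + G B\<close> gives \<open>A dF = B dG\<close>. With it, the logarithmic derivative of
  \<open>A F / (B G)\<close> is a multiple of \<open>G + F A - F - G B = 0\<close>, so \<open>A F = \<theta> B G\<close> for a constant \<open>\<theta> > 0\<close> as
  long as \<open>F, G < 1\<close>. Hence \<open>dG / G = \<theta> dF / F\<close> there, and \<open>ln G - \<theta> ln F\<close> is constant. By continuity
  \<open>A F = \<theta> B G\<close> also at the first point where \<open>F\<close> or \<open>G\<close> reaches \<open>1\<close>, which forces both to reach \<open>1\<close>
  at the same point (or at infinity), so the constant is \<open>0\<close>.

  Conversely, if \<open>G = F powr \<theta>\<close> then \<open>(\<theta> - 1) A + \<theta> G / F\<close> has zero derivative and equals \<open>\<theta>\<close>; the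
  analogous identity for \<open>B\<close> then gives commutativity.

  Since densities need not be continuous, nothing is differentiated with respect to \<open>x\<close>: increments
  are compared modulo \<open>o(\<bar>\<Delta>F\<bar> + \<bar>\<Delta>G\<bar>)\<close>, which allows sums, products and smooth functions, and
  a function with zero derivative in this sense is constant.
\<close>

section \<open>Calculus of increments modulo
  \<open>o(\<bar>dF\<bar> + \<bar>dG\<bar>)\<close>\<close>

definition incr :: "(real \<Rightarrow> real) \<Rightarrow> real \<times> real \<Rightarrow> real" where
  "incr f p = f (snd p) - f (fst p)"

text \<open>\<open>df = a dF + b dG\<close> at \<open>x\<close>, in the strict sense: both endpoints of the increment vary.\<close>

definition has_stieltjes_deriv ::
    "(real \<Rightarrow> real) \<Rightarrow> (real \<Rightarrow> real) \<Rightarrow> (real \<Rightarrow> real) \<Rightarrow> real \<Rightarrow> real \<Rightarrow> real \<Rightarrow> bool" where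
  "has_stieltjes_deriv F G f a b x \<longleftrightarrow>
     (\<lambda>p. incr f p - (a * incr F p + b * incr G p)) \<in> o[nhds (x, x)](\<lambda>p. \<bar>incr F p\<bar> + \<bar>incr G p\<bar>)"

lemma has_stieltjes_deriv_swap:
  "has_stieltjes_deriv F G f a b x \<Longrightarrow> has_stieltjes_deriv G F f b a x"
  by (simp add: has_stieltjes_deriv_def add.commute)

lemma has_stieltjes_deriv_left: "has_stieltjes_deriv F G F 1 0 x"
  and has_stieltjes_deriv_right: "has_stieltjes_deriv F G G 0 1 x"
  by (simp_all add: has_stieltjes_deriv_def incr_def)

lemma has_stieltjes_deriv_add:
  assumes "has_stieltjes_deriv F G f a b x" "has_stieltjes_deriv F G g c d x"
  shows "has_stieltjes_deriv F G (\<lambda>t. f t + g t) (a + c) (b + d) x"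
  using sum_in_smallo(1)[OF assms[unfolded has_stieltjes_deriv_def]]
  by (simp add: has_stieltjes_deriv_def incr_def algebra_simps)

lemma has_stieltjes_deriv_cmult:
  assumes "has_stieltjes_deriv F G f a b x"
  shows "has_stieltjes_deriv F G (\<lambda>t. k * f t) (k * a) (k * b) x"
proof -
  have "(\<lambda>p. k * (incr f p - (a * incr F p + b * incr G p)))
      \<in> o[nhds (x, x)](\<lambda>p. \<bar>incr F p\<bar> + \<bar>incr G p\<bar>)"
    using assms by (cases "k = 0") (simp_all add: has_stieltjes_deriv_def)
  then show ?thesis
    by (simp add: has_stieltjes_deriv_def incr_def algebra_simps)
qed

lemma has_stieltjes_deriv_diff:
  assumes "has_stieltjes_deriv F G f a b x" "has_stieltjes_deriv F G g c d x"
  shows "has_stieltjes_deriv F G (\<lambda>t. f t - g t) (a - c) (b - d) x"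
  using sum_in_smallo(2)[OF assms[unfolded has_stieltjes_deriv_def]]
  by (simp add: has_stieltjes_deriv_def incr_def algebra_simps)

text \<open>Lets error terms of the form \<open>o(1) * incr f\<close> or \<open>o(incr f)\<close> be
  absorbed into the reference scale; the product and chain rules rest on this.\<close>

lemma has_stieltjes_deriv_bigo:
  assumes "has_stieltjes_deriv F G f a b x"
  shows "incr f \<in> O[nhds (x, x)](\<lambda>p. \<bar>incr F p\<bar> + \<bar>incr G p\<bar>)"
proof -
  have "(\<lambda>p. a * incr F p + b * incr G p) \<in> O[nhds (x, x)](\<lambda>p. \<bar>incr F p\<bar> + \<bar>incr G p\<bar>)"
  proof (rule bigoI[of _ "\<bar>a\<bar> + \<bar>b\<bar>"], rule always_eventually, rule allI)
    fix p
    have "\<bar>a * incr F p + b * incr G p\<bar> \<le> \<bar>a\<bar> * \<bar>incr F p\<bar> + \<bar>b\<bar> * \<bar>incr G p\<bar>"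
      by (metis abs_mult abs_triangle_ineq)
    also have "\<dots> \<le> (\<bar>a\<bar> + \<bar>b\<bar>) * (\<bar>incr F p\<bar> + \<bar>incr G p\<bar>)"
      by (simp add: algebra_simps)
    finally show "norm (a * incr F p + b * incr G p) \<le> (\<bar>a\<bar> + \<bar>b\<bar>) * norm (\<bar>incr F p\<bar> + \<bar>incr G p\<bar>)"
      by simp
  qed
  from sum_in_bigo(1)[OF landau_o.small_imp_big[OF assms[unfolded has_stieltjes_deriv_def]] this]
  show ?thesis by simp
qed

lemma tendsto_smallo_1:
  fixes f :: "'a \<Rightarrow> real"
  assumes "(f \<longlongrightarrow> l) net"
  shows "(\<lambda>p. f p - l) \<in> o[net](\<lambda>_. 1)"
  by (rule smalloI_tendsto) (use assms in \<open>simp_all add: LIM_zero_iff\<close>)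

lemma isCont_tendsto_pair:
  fixes f :: "real \<Rightarrow> real"
  assumes "isCont f x"
  shows "((\<lambda>p. f (fst p)) \<longlongrightarrow> f x) (nhds (x, x))" "((\<lambda>p. f (snd p)) \<longlongrightarrow> f x) (nhds (x, x))"
proof -
  have f: "(f \<longlongrightarrow> f x) (nhds x)"
    using assms by (simp add: isCont_def tendsto_at_iff_tendsto_nhds)
  have "filterlim fst (nhds x) (nhds (x, x))" "filterlim snd (nhds x) (nhds (x, x))"
    by (simp_all add: nhds_prod filterlim_fst filterlim_snd)
  then show "((\<lambda>p. f (fst p)) \<longlongrightarrow> f x) (nhds (x, x))" "((\<lambda>p. f (snd p)) \<longlongrightarrow> f x) (nhds (x, x))"
    by (auto intro: filterlim_compose[OF f])
qed

text \<open>For an increment from \<open>u\<close> to \<open>v\<close>, the product changes by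
  \<open>f v * dg + g u * df\<close>. By continuity, replacing \<open>f v\<close> and
  \<open>g u\<close> by their values at \<open>x\<close> costs \<open>o(1)\<close> times an
  increment.\<close>

lemma has_stieltjes_deriv_mult:
  assumes f: "has_stieltjes_deriv F G f a b x" "isCont f x"
    and g: "has_stieltjes_deriv F G g c d x" "isCont g x"
  shows "has_stieltjes_deriv F G (\<lambda>t. f t * g t) (a * g x + f x * c) (b * g x + f x * d) x"
proof -
  let ?H = "\<lambda>p. \<bar>incr F p\<bar> + \<bar>incr G p\<bar>"
  have 1: "(\<lambda>p. (f (snd p) - f x) * incr g p) \<in> o[nhds (x, x)](?H)"
    using landau_o.small_big_mult[OF tendsto_smallo_1[OF isCont_tendsto_pair(2)[OF f(2)]]
        has_stieltjes_deriv_bigo[OF g(1)]] by simp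
  have 2: "(\<lambda>p. (g (fst p) - g x) * incr f p) \<in> o[nhds (x, x)](?H)"
    using landau_o.small_big_mult[OF tendsto_smallo_1[OF isCont_tendsto_pair(1)[OF g(2)]]
        has_stieltjes_deriv_bigo[OF f(1)]] by simp
  have 3: "(\<lambda>p. incr (\<lambda>t. g x * f t + f x * g t) p
       - ((g x * a + f x * c) * incr F p + (g x * b + f x * d) * incr G p)) \<in> o[nhds (x, x)](?H)"
    using has_stieltjes_deriv_add[OF has_stieltjes_deriv_cmult[OF f(1), of "g x"]
        has_stieltjes_deriv_cmult[OF g(1), of "f x"]]
    by (simp add: has_stieltjes_deriv_def)
  have "(\<lambda>p. (f (snd p) - f x) * incr g p + (g (fst p) - g x) * incr f p
      + (incr (\<lambda>t. g x * f t + f x * g t) p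
       - ((g x * a + f x * c) * incr F p + (g x * b + f x * d) * incr G p))) \<in> o[nhds (x, x)](?H)"
    by (intro sum_in_smallo 1 2 3)
  then show ?thesis
    by (simp add: has_stieltjes_deriv_def incr_def algebra_simps)
qed

text \<open>Both endpoints vary, so differentiability of \<open>h\<close> at the one point
  \<open>f x\<close> would be too weak. The mean value inequality for
  \<open>h u - h' (f x) * u\<close>, whose derivative is small near \<open>f x\<close> by continuity
  of \<open>h'\<close>, gives the strict estimate.\<close>

lemma has_stieltjes_deriv_compose:
  assumes f: "has_stieltjes_deriv F G f a b x" "isCont f x"
    and h: "\<forall>\<^sub>F u in nhds (f x). (h has_real_derivative h' u) (at u)" and h': "isCont h' (f x)"
  shows "has_stieltjes_deriv F G (\<lambda>t. h (f t)) (h' (f x) * a) (h' (f x) * b) x"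
proof -
  let ?H = "\<lambda>p. \<bar>incr F p\<bar> + \<bar>incr G p\<bar>"
  have 1: "(\<lambda>p. incr (\<lambda>t. h (f t)) p - h' (f x) * incr f p) \<in> o[nhds (x, x)](incr f)"
  proof (rule landau_o.smallI)
    fix c :: real assume "c > 0"
    have "\<forall>\<^sub>F u in nhds (f x). \<bar>h' u - h' (f x)\<bar> < c"
      using tendstoD[OF h'[unfolded isCont_def tendsto_at_iff_tendsto_nhds] \<open>c > 0\<close>]
      by (simp add: dist_real_def)
    with h have "\<forall>\<^sub>F u in nhds (f x). (h has_real_derivative h' u) (at u) \<and> \<bar>h' u - h' (f x)\<bar> < c"
      by eventually_elim simp
    then obtain d where "d > 0" and d: "\<And>u. dist u (f x) < d \<Longrightarrow>
        (h has_real_derivative h' u) (at u) \<and> \<bar>h' u - h' (f x)\<bar> < c"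
      unfolding eventually_nhds_metric by blast
    have bound: "\<bar>(h v - h' (f x) * v) - (h u - h' (f x) * u)\<bar> \<le> c * \<bar>v - u\<bar>"
      if "u \<in> ball (f x) d" "v \<in> ball (f x) d" for u v
    proof -
      have D: "((\<lambda>u. h u - h' (f x) * u) has_field_derivative h' w - h' (f x)) (at w within ball (f x) d)"
        if "w \<in> ball (f x) d" for w
      proof -
        have "(h has_field_derivative h' w) (at w within ball (f x) d)"
          using d[of w] that by (auto simp: dist_commute intro: DERIV_subset)
        from DERIV_diff[OF this DERIV_cmult[OF DERIV_ident, of "h' (f x)"]]
        show ?thesis by simp
      qed
      have "norm (h' w - h' (f x)) \<le> c" if "w \<in> ball (f x) d" for w
        using d[of w] that by (simp add: dist_commute less_imp_le)
      from field_differentiable_bound[OF _ D this] that show ?thesis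
        by simp
    qed
    have "\<forall>\<^sub>F p in nhds (x, x). dist (f (fst p)) (f x) < d" "\<forall>\<^sub>F p in nhds (x, x). dist (f (snd p)) (f x) < d"
      by (intro tendstoD isCont_tendsto_pair f(2) \<open>d > 0\<close>)+
    then show "\<forall>\<^sub>F p in nhds (x, x). norm (incr (\<lambda>t. h (f t)) p - h' (f x) * incr f p) \<le> c * norm (incr f p)"
    proof eventually_elim
      case (elim p)
      then show ?case
        using bound[of "f (fst p)" "f (snd p)"]
        by (simp add: incr_def dist_commute algebra_simps)
    qed
  qed
  have 2: "(\<lambda>p. incr (\<lambda>t. h' (f x) * f t) p - (h' (f x) * a * incr F p + h' (f x) * b * incr G p))
      \<in> o[nhds (x, x)](?H)"
    using has_stieltjes_deriv_cmult[OF f(1), of "h' (f x)"] by (simp add: has_stieltjes_deriv_def)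
  from sum_in_smallo(1)[OF landau_o.small_big_trans[OF 1 has_stieltjes_deriv_bigo[OF f(1)]] 2]
  show ?thesis by (simp add: has_stieltjes_deriv_def incr_def algebra_simps)
qed

lemma has_stieltjes_deriv_ln:
  assumes "has_stieltjes_deriv F G f a b x" "isCont f x" "f x > 0"
  shows "has_stieltjes_deriv F G (\<lambda>t. ln (f t)) (a / f x) (b / f x) x"
proof -
  have "\<forall>\<^sub>F u in nhds (f x). u > 0"
    using assms(3) by (intro eventually_nhds_in_open[of "{0<..}", simplified]) auto
  then have "\<forall>\<^sub>F u in nhds (f x). (ln has_real_derivative 1 / u) (at u)"
    by eventually_elim (auto intro!: derivative_eq_intros)
  from has_stieltjes_deriv_compose[OF assms(1,2) this] assms(3) show ?thesis
    by (auto intro!: continuous_intros)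
qed

lemma has_stieltjes_deriv_inverse:
  assumes "has_stieltjes_deriv F G f a b x" "isCont f x" "f x \<noteq> 0"
  shows "has_stieltjes_deriv F G (\<lambda>t. inverse (f t)) (- (a / (f x)\<^sup>2)) (- (b / (f x)\<^sup>2)) x"
proof -
  have "\<forall>\<^sub>F u in nhds (f x). u \<noteq> 0"
    using assms(3) by (intro eventually_nhds_in_open[of "- {0}", simplified]) auto
  then have "\<forall>\<^sub>F u in nhds (f x). (inverse has_real_derivative - (1 / u\<^sup>2)) (at u)"
    by eventually_elim (auto intro!: derivative_eq_intros simp: field_simps power2_eq_square)
  from has_stieltjes_deriv_compose[OF assms(1,2) this] assms(3) show ?thesis
    by (auto intro!: continuous_intros)
qed

lemma has_stieltjes_deriv_cong:
  assumes "has_stieltjes_deriv F G f a b x" "\<forall>\<^sub>F t in nhds x. f t = g t"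
  shows "has_stieltjes_deriv F G g a b x"
proof -
  have "\<forall>\<^sub>F p in nhds (x, x). f (fst p) = g (fst p)" "\<forall>\<^sub>F p in nhds (x, x). f (snd p) = g (snd p)"
    using assms(2) by (auto simp: nhds_prod intro: eventually_compose_filterlim filterlim_fst filterlim_snd)
  then have "\<forall>\<^sub>F p in nhds (x, x).
      incr g p - (a * incr F p + b * incr G p) = incr f p - (a * incr F p + b * incr G p)"
    by eventually_elim (simp add: incr_def)
  from landau_o.small.in_cong[OF this] assms(1) show ?thesis
    by (simp add: has_stieltjes_deriv_def)
qed

section \<open>Null pairs and functions with zero derivative\<close>

text \<open>
  Derivatives are not unique: a pair \<open>(a, b)\<close> is a derivative of \<open>0\<close> when \<open>a dF + b dG = 0\<close>, and
  derivatives are only determined modulo such pairs.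
\<close>

lemma has_stieltjes_deriv_mod_null:
  assumes "has_stieltjes_deriv F G f (k * a) (k * b) x" "has_stieltjes_deriv F G (\<lambda>_. 0) a b x"
  shows "has_stieltjes_deriv F G f 0 0 x"
  using has_stieltjes_deriv_diff[OF assms(1) has_stieltjes_deriv_cmult[OF assms(2), of k]] by simp

text \<open>For each \<open>e > 0\<close>, the bound of the increment of \<open>f\<close> by
  \<open>e\<close> times the increment of \<open>F + G\<close> passes from adjacent intervals to
  their union and holds on short intervals around each point. Bisection extends it to
  \<open>[s, t]\<close>, and then \<open>e\<close> tends to \<open>0\<close>.\<close>

lemma has_stieltjes_deriv_zero_const:
  assumes mono: "mono F" "mono G" and "s \<le> t"
    and f: "\<And>x. s \<le> x \<Longrightarrow> x \<le> t \<Longrightarrow> has_stieltjes_deriv F G f 0 0 x"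
  shows "f s = f t"
proof -
  have "\<bar>f t - f s\<bar> \<le> e * (F t - F s + (G t - G s))" if "e > 0" for e
    using \<open>s \<le> t\<close>
  proof (induction rule: Bolzano)
    case (trans u v w)
    have "\<bar>f w - f u\<bar> \<le> \<bar>f w - f v\<bar> + \<bar>f v - f u\<bar>" by simp
    also have "\<dots> \<le> e * (F w - F v + (G w - G v)) + e * (F v - F u + (G v - G u))"
      using trans by linarith
    finally show ?case by (simp add: algebra_simps)
  next
    case (local x)
    have "\<forall>\<^sub>F p in nhds (x, x). \<bar>incr f p\<bar> \<le> e * \<bar>\<bar>incr F p\<bar> + \<bar>incr G p\<bar>\<bar>"
      using landau_o.smallD[OF f[OF local, unfolded has_stieltjes_deriv_def] that] by simp
    \<comment> \<open>The neighbourhood filter of \<open>(x, x)\<close> is a product, so the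
      condition on pairs splits into one condition per endpoint.\<close>
    then obtain P Q where PQ: "eventually P (nhds x)" "eventually Q (nhds x)"
      "\<And>u v. P u \<Longrightarrow> Q v \<Longrightarrow> \<bar>incr f (u, v)\<bar> \<le> e * \<bar>\<bar>incr F (u, v)\<bar> + \<bar>incr G (u, v)\<bar>\<bar>"
      unfolding nhds_prod eventually_prod_filter by blast
    obtain d where "d > 0" and d: "\<And>y. dist y x < d \<Longrightarrow> P y \<and> Q y"
      using eventually_conj[OF PQ(1,2)] unfolding eventually_nhds_metric by blast
    have "\<bar>f v - f u\<bar> \<le> e * (F v - F u + (G v - G u))" if "u \<le> x" "x \<le> v" "v - u < d" for u v
    proof -
      have "F u \<le> F v" "G u \<le> G v" using mono that by (auto simp: mono_def)
      moreover have "P u" "Q v" using d[of u] d[of v] that by (auto simp: dist_real_def)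
      ultimately show ?thesis using PQ(3)[of u v] by (simp add: incr_def)
    qed
    with \<open>d > 0\<close> show ?case by blast
  qed
  then have *: "\<bar>f t - f s\<bar> \<le> e * (F t - F s + (G t - G s))" if "e > 0" for e
    using that by blast
  have "((\<lambda>e. e * (F t - F s + (G t - G s))) \<longlongrightarrow> 0 * (F t - F s + (G t - G s))) (at_right 0)"
    by (intro tendsto_intros)
  then have "\<bar>f t - f s\<bar> \<le> 0 * (F t - F s + (G t - G s))"
    by (rule tendsto_lowerbound) (simp_all add: * eventually_at_filter)
  then show ?thesis by simp
qed


lemma has_stieltjes_deriv_isCont:
  assumes f: "has_stieltjes_deriv F G f a b x" and F: "isCont F x" and G: "isCont G x"
  shows "isCont f x"
proof -
  have "((\<lambda>p. \<bar>incr F p\<bar> + \<bar>incr G p\<bar>) \<longlongrightarrow> \<bar>F x - F x\<bar> + \<bar>G x - G x\<bar>) (nhds (x, x))"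
    unfolding incr_def by (intro tendsto_intros isCont_tendsto_pair F G)
  then have "(\<lambda>p. \<bar>incr F p\<bar> + \<bar>incr G p\<bar>) \<in> o[nhds (x, x)](\<lambda>_. 1)"
    using tendsto_smallo_1 by fastforce
  from landau_o.big_small_trans[OF has_stieltjes_deriv_bigo[OF f] this]
  have "(incr f \<longlongrightarrow> 0) (nhds (x, x))"
    using smalloD_tendsto by fastforce
  \<comment> \<open>Freezing the left endpoint at \<open>x\<close> turns the two-sided estimate into
    ordinary continuity.\<close>
  moreover have "filterlim (Pair x) (nhds (x, x)) (at x)"
    by (intro tendsto_intros)
  ultimately have "((\<lambda>t. incr f (x, t)) \<longlongrightarrow> 0) (at x)"
    by (rule filterlim_compose)
  then show ?thesis
    by (simp add: incr_def isCont_def LIM_zero_iff)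
qed

section \<open>The abstract setting: bounds, continuity and derivatives of \<open>A\<close> and
  \<open>B\<close>\<close>

text \<open>
  \<open>A x\<close> and \<open>B x\<close> stand for the integrals of \<open>1 / F\<close> against \<open>dG\<close> and of \<open>1 / G\<close> against \<open>dF\<close>
  over \<open>(x, \<infinity>)\<close>. The increment bounds and the limit at infinity are all that is used of them.
\<close>

locale relevation_pair =
  fixes F G A B :: "real \<Rightarrow> real"
  assumes mono: "mono F" "mono G"
    and cont: "isCont F x" "isCont G x"
    and zero: "F 0 = 0" "G 0 = 0"
    and lim: "(F \<longlongrightarrow> 1) at_top" "(G \<longlongrightarrow> 1) at_top"
    and pos: "x > 0 \<Longrightarrow> F x > 0" "x > 0 \<Longrightarrow> G x > 0"
    and A_lower: "0 < s \<Longrightarrow> s \<le> t \<Longrightarrow> (G t - G s) / F t \<le> A s - A t"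
    and A_upper: "0 < s \<Longrightarrow> s \<le> t \<Longrightarrow> A s - A t \<le> (G t - G s) / F s"
    and A_lim: "(A \<longlongrightarrow> 0) at_top"
    and B_lower: "0 < s \<Longrightarrow> s \<le> t \<Longrightarrow> (F t - F s) / G t \<le> B s - B t"
    and B_upper: "0 < s \<Longrightarrow> s \<le> t \<Longrightarrow> B s - B t \<le> (F t - F s) / G s"
    and B_lim: "(B \<longlongrightarrow> 0) at_top"
begin

text \<open>The assumptions are symmetric, so each fact proved for \<open>A\<close> yields its
  mirror image for \<open>B\<close>.\<close>

lemma swap: "relevation_pair G F B A"
  by (unfold_locales; fact mono cont zero lim pos A_lower A_upper A_lim B_lower B_upper B_lim)

lemma F_le_1: "F x \<le> 1"
proof (rule tendsto_lowerbound[OF lim(1)])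
  show "\<forall>\<^sub>F t in at_top. F x \<le> F t"
    using eventually_ge_at_top[of x] by eventually_elim (use mono(1) in \<open>auto simp: mono_def\<close>)
qed simp

text \<open>Since \<open>F \<le> 1\<close>, the integrand \<open>1 / F\<close> is at least
  \<open>1\<close>; formally, \<open>A_lower\<close> is taken to the limit \<open>t\<close> to
  infinity.\<close>

lemma A_ge:
  assumes "x > 0"
  shows "1 - G x \<le> A x"
proof -
  have "((\<lambda>t. A x - A t - (G t - G x)) \<longlongrightarrow> A x - 0 - (1 - G x)) at_top"
    by (intro tendsto_intros A_lim lim)
  then have "0 \<le> A x - 0 - (1 - G x)"
  proof (rule tendsto_lowerbound)
    show "\<forall>\<^sub>F t in at_top. 0 \<le> A x - A t - (G t - G x)"
      using eventually_ge_at_top[of x]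
    proof eventually_elim
      case (elim t)
      then have "G x \<le> G t" "F t > 0" "F t \<le> 1"
        using mono(2) pos(1) F_le_1 assms by (auto simp: mono_def)
      then have "(G t - G x) * 1 \<le> (G t - G x) * (1 / F t)"
        by (intro mult_left_mono) auto
      then show ?case using A_lower[OF assms elim] by simp
    qed
  qed simp
  then show ?thesis by simp
qed

lemma A_le:
  assumes "x > 0"
  shows "A x \<le> (1 - G x) / F x"
proof -
  have "((\<lambda>t. (G t - G x) / F x - (A x - A t)) \<longlongrightarrow> (1 - G x) / F x - (A x - 0)) at_top"
    using pos(1)[OF assms] by (intro tendsto_intros A_lim lim) auto
  then have "0 \<le> (1 - G x) / F x - (A x - 0)"
  proof (rule tendsto_lowerbound)
    show "\<forall>\<^sub>F t in at_top. 0 \<le> (G t - G x) / F x - (A x - A t)"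
      using eventually_ge_at_top[of x] by eventually_elim (use A_upper[OF assms] in auto)
  qed simp
  then show ?thesis by simp
qed

text \<open>The increment of \<open>A\<close> lies between those of \<open>- G / F s\<close> and
  \<open>- G / F t\<close> with the denominators frozen at the endpoints, and both
  \<open>1 / F s\<close> and \<open>1 / F t\<close> are close to \<open>1 / F x\<close>.\<close>

lemma A_deriv:
  assumes "x > 0"
  shows "has_stieltjes_deriv F G A 0 (- (1 / F x)) x"
  unfolding has_stieltjes_deriv_def
proof (rule landau_o.smallI)
  fix c :: real assume "c > 0"
  have bound: "\<bar>A t - A s + (G t - G s) / F x\<bar> \<le> c * \<bar>G t - G s\<bar>"
    if "0 < s" "s \<le> t" "\<bar>1 / F s - 1 / F x\<bar> < c" "\<bar>1 / F t - 1 / F x\<bar> < c" for s t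
  proof -
    have G: "G t - G s \<ge> 0" using mono(2) that by (simp add: mono_def)
    have "(G t - G s) * (1 / F s - 1 / F x) \<le> (G t - G s) * c"
      "(G t - G s) * (- c) \<le> (G t - G s) * (1 / F t - 1 / F x)"
      by (rule mult_left_mono; use G that in simp)+
    then show ?thesis
      using A_lower[OF that(1,2)] A_upper[OF that(1,2)] G
      by (simp add: abs_if diff_divide_distrib algebra_simps)
  qed
  have cont_inv: "isCont (\<lambda>t. 1 / F t) x"
    using pos(1)[OF assms] by (intro continuous_intros cont) auto
  have id: "isCont (\<lambda>t. t) x" by simp
  have "\<forall>\<^sub>F p in nhds (x, x). 0 < fst p" "\<forall>\<^sub>F p in nhds (x, x). 0 < snd p"
    by (intro order_tendstoD(1)[OF isCont_tendsto_pair(1)[OF id]] assms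
        order_tendstoD(1)[OF isCont_tendsto_pair(2)[OF id]])+
  moreover have "\<forall>\<^sub>F p in nhds (x, x). dist (1 / F (fst p)) (1 / F x) < c"
    "\<forall>\<^sub>F p in nhds (x, x). dist (1 / F (snd p)) (1 / F x) < c"
    by (intro tendstoD isCont_tendsto_pair[OF cont_inv] \<open>c > 0\<close>)+
  ultimately show "\<forall>\<^sub>F p in nhds (x, x).
      norm (incr A p - (0 * incr F p + - (1 / F x) * incr G p)) \<le> c * norm (\<bar>incr F p\<bar> + \<bar>incr G p\<bar>)"
  proof eventually_elim
    case (elim p)
    have "\<bar>incr A p + incr G p / F x\<bar> \<le> c * \<bar>incr G p\<bar>"
    proof (cases "fst p \<le> snd p")
      case True
      with bound[of "fst p" "snd p"] elim show ?thesis
        by (simp add: incr_def dist_real_def)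
    next
      case False
      have "A (fst p) - A (snd p) + (G (fst p) - G (snd p)) / F x = - (incr A p + incr G p / F x)"
        by (simp add: incr_def diff_divide_distrib)
      with bound[of "snd p" "fst p"] elim False show ?thesis
        by (simp add: incr_def dist_real_def abs_minus_commute)
    qed
    also have "c * \<bar>incr G p\<bar> \<le> c * (\<bar>incr F p\<bar> + \<bar>incr G p\<bar>)"
      using \<open>c > 0\<close> by simp
    finally show ?case by simp
  qed
qed

lemma A_cont: "x > 0 \<Longrightarrow> isCont A x"
  using A_deriv cont by (rule has_stieltjes_deriv_isCont)

lemma B_deriv: "x > 0 \<Longrightarrow> has_stieltjes_deriv F G B (- (1 / G x)) 0 x"
  using has_stieltjes_deriv_swap[OF relevation_pair.A_deriv[OF swap]] .

lemma zero_const_on: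
  assumes "s > 0" "s \<le> t" "\<And>x. 0 < x \<Longrightarrow> x \<le> t \<Longrightarrow> has_stieltjes_deriv F G f 0 0 x"
  shows "f s = f t"
  using has_stieltjes_deriv_zero_const[OF mono assms(2)] assms by simp

lemma zero_const_lim:
  assumes deriv: "\<And>y. y > 0 \<Longrightarrow> has_stieltjes_deriv F G f 0 0 y"
    and f: "(f \<longlongrightarrow> l) at_top" and "x > 0"
  shows "f x = l"
proof -
  have "\<forall>\<^sub>F t in at_top. f t = f x"
    using eventually_ge_at_top[of x]
    by eventually_elim (use zero_const_on[of x _ f] deriv \<open>x > 0\<close> in simp)
  then have "(f \<longlongrightarrow> f x) at_top"
    by (rule tendsto_eventually)
  with f show ?thesis
    using tendsto_unique[of at_top f] by simp
qed

section \<open>Proportional reversed hazards imply commutativity\<close>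

text \<open>The left-hand side is constant in \<open>x\<close> and tends to \<open>\<theta>\<close>
  at infinity.\<close>

lemma A_powr:
  assumes G: "\<And>x. x > 0 \<Longrightarrow> G x = F x powr \<theta>" and "x > 0"
  shows "(\<theta> - 1) * A x + \<theta> * (G x / F x) = \<theta>"
proof -
  define h where "h t = (\<theta> - 1) * A t + \<theta> * (G t / F t)" for t
  have deriv: "has_stieltjes_deriv F G h 0 0 y" if "y > 0" for y
  proof -
    have F: "F y > 0" and G': "G y > 0" using pos that by auto
    have "has_stieltjes_deriv F G (\<lambda>t. ln (G t) - \<theta> * ln (F t)) (0 / G y - \<theta> * (1 / F y)) (1 / G y - \<theta> * (0 / F y)) y"
      by (intro has_stieltjes_deriv_diff has_stieltjes_deriv_cmult has_stieltjes_deriv_ln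
          has_stieltjes_deriv_left has_stieltjes_deriv_right cont F G')
    \<comment> \<open>The difference vanishes near \<open>y\<close>, so its derivative, the relation
      \<open>dG / G - \<theta> dF / F = 0\<close>, is a null pair.\<close>
    moreover have "\<forall>\<^sub>F t in nhds y. ln (G t) - \<theta> * ln (F t) = 0"
      using eventually_nhds_in_open[OF open_greaterThan, of y 0] that
      by (auto elim!: eventually_mono simp: G ln_powr)
    ultimately have null: "has_stieltjes_deriv F G (\<lambda>_. 0) (0 / G y - \<theta> * (1 / F y)) (1 / G y - \<theta> * (0 / F y)) y"
      by (rule has_stieltjes_deriv_cong)
    have "has_stieltjes_deriv F G (\<lambda>t. (\<theta> - 1) * A t + \<theta> * (G t * inverse (F t)))
        ((\<theta> - 1) * 0 + \<theta> * (0 * inverse (F y) + G y * - (1 / (F y)\<^sup>2)))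
        ((\<theta> - 1) * - (1 / F y) + \<theta> * (1 * inverse (F y) + G y * - (0 / (F y)\<^sup>2))) y"
      using F that by (intro has_stieltjes_deriv_add has_stieltjes_deriv_cmult has_stieltjes_deriv_mult
          has_stieltjes_deriv_inverse has_stieltjes_deriv_left has_stieltjes_deriv_right cont A_deriv
          continuous_intros) auto
    \<comment> \<open>Both coefficients are \<open>G y / F y\<close> times those of the null
      pair.\<close>
    also have "(\<theta> - 1) * 0 + \<theta> * (0 * inverse (F y) + G y * - (1 / (F y)\<^sup>2)) = G y / F y * (0 / G y - \<theta> * (1 / F y))"
      using F G' by (simp add: field_simps power2_eq_square)
    also have "(\<theta> - 1) * - (1 / F y) + \<theta> * (1 * inverse (F y) + G y * - (0 / (F y)\<^sup>2))
        = G y / F y * (1 / G y - \<theta> * (0 / F y))"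
      using F G' by (simp add: field_simps)
    finally show ?thesis
      using has_stieltjes_deriv_mod_null[OF _ null] by (simp add: h_def[abs_def] divide_inverse)
  qed
  have "(h \<longlongrightarrow> (\<theta> - 1) * 0 + \<theta> * (1 / 1)) at_top"
    unfolding h_def by (intro tendsto_intros A_lim lim) auto
  with deriv have "h x = \<theta>"
    using zero_const_lim[of h \<theta> x] \<open>x > 0\<close> by simp
  then show ?thesis by (simp add: h_def)
qed

text \<open>The mirror image of \<open>A_powr\<close>, with exponent \<open>1 / \<theta>\<close>,
  multiplied by \<open>\<theta>\<close>.\<close>

lemma B_powr:
  assumes G: "\<And>x. x > 0 \<Longrightarrow> G x = F x powr \<theta>" and "\<theta> > 0" "x > 0"
  shows "(1 - \<theta>) * B x + F x / G x = 1"
proof -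
  have "F x = G x powr (1 / \<theta>)" if "x > 0" for x
    using assms(2) pos(1)[OF that] by (simp add: G that powr_powr)
  from relevation_pair.A_powr[OF swap this \<open>x > 0\<close>] have "(1 / \<theta> - 1) * B x + 1 / \<theta> * (F x / G x) = 1 / \<theta>" .
  then have "\<theta> * ((1 / \<theta> - 1) * B x + 1 / \<theta> * (F x / G x)) = \<theta> * (1 / \<theta>)" by simp
  also have "\<theta> * (1 / \<theta>) = 1"
    using \<open>\<theta> > 0\<close> by simp
  also have "\<theta> * ((1 / \<theta> - 1) * B x + 1 / \<theta> * (F x / G x)) = (\<theta> * (1 / \<theta>) - \<theta>) * B x + \<theta> * (1 / \<theta>) * (F x / G x)"
    by (simp only: algebra_simps)
  finally show ?thesis using \<open>\<theta> > 0\<close> by simp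
qed

text \<open>\<open>A_powr\<close> and \<open>B_powr\<close> determine \<open>F * A\<close> and
  \<open>G * B\<close> only up to the factor \<open>\<theta> - 1\<close>. At
  \<open>\<theta> = 1\<close> they say nothing about \<open>A\<close> and \<open>B\<close>, and
  \<open>A = B\<close> is shown directly.\<close>

lemma powr_imp_commute:
  assumes G: "\<And>x. x > 0 \<Longrightarrow> G x = F x powr \<theta>" and "\<theta> > 0" "x > 0"
  shows "G x + F x * A x = F x + G x * B x"
proof (cases "\<theta> = 1")
  case True
  then have eq: "G y = F y" if "y > 0" for y
    using G[OF that] pos(1)[OF that] by simp
  have "A x - B x = 0"
  proof (rule zero_const_lim[of "\<lambda>t. A t - B t", OF _ _ \<open>x > 0\<close>])
    show "((\<lambda>t. A t - B t) \<longlongrightarrow> 0) at_top"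
      using tendsto_diff[OF A_lim B_lim] by simp
  next
    fix y :: real assume "y > 0"
    have "has_stieltjes_deriv F G (\<lambda>t. F t - G t) 1 (- 1) y"
      using has_stieltjes_deriv_diff[OF has_stieltjes_deriv_left has_stieltjes_deriv_right] by simp
    moreover have "\<forall>\<^sub>F t in nhds y. F t - G t = 0"
      using eventually_nhds_in_open[OF open_greaterThan, of y 0] \<open>y > 0\<close>
      by (auto elim!: eventually_mono simp: eq)
    ultimately have "has_stieltjes_deriv F G (\<lambda>_. 0) 1 (- 1) y"
      by (rule has_stieltjes_deriv_cong)
    moreover have "has_stieltjes_deriv F G (\<lambda>t. A t - B t) (1 / F y * 1) (1 / F y * - 1) y"
      using has_stieltjes_deriv_diff[OF A_deriv B_deriv, OF \<open>y > 0\<close> \<open>y > 0\<close>] eq[OF \<open>y > 0\<close>] by simp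
    ultimately show "has_stieltjes_deriv F G (\<lambda>t. A t - B t) 0 0 y"
      using has_stieltjes_deriv_mod_null by blast
  qed
  then show ?thesis using eq \<open>x > 0\<close> by simp
next
  case False
  have "F x > 0" "G x > 0" using pos \<open>x > 0\<close> by auto
  have "(\<theta> - 1) * (F x * A x) = \<theta> * F x - \<theta> * G x"
    using A_powr[OF G \<open>x > 0\<close>] \<open>F x > 0\<close> by (simp add: field_simps) 
  moreover have "(\<theta> - 1) * (G x * B x) = F x - G x"
    using B_powr[OF G \<open>\<theta> > 0\<close> \<open>x > 0\<close>] \<open>G x > 0\<close> by (simp add: field_simps)
  ultimately have "(\<theta> - 1) * (G x + F x * A x) = (\<theta> - 1) * (F x + G x * B x)"
    by (simp add: algebra_simps)
  with False show ?thesis by simp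
qed

section \<open>Commutativity implies proportional reversed hazards\<close>

lemma A_pos: "x > 0 \<Longrightarrow> G x < 1 \<Longrightarrow> A x > 0"
  using A_ge[of x] by simp

lemma B_pos: "x > 0 \<Longrightarrow> F x < 1 \<Longrightarrow> B x > 0"
  using relevation_pair.A_pos[OF swap] .

lemma F_small: "\<forall>\<^sub>F x in at_right 0. F x < 1"
proof -
  have "(F \<longlongrightarrow> 0) (at_right 0)"
    using cont(1)[of 0] zero by (simp add: isCont_def filterlim_at_split)
  then show ?thesis by (rule order_tendstoD) simp
qed

text \<open>\<open>F b = 1\<close> leaves no mass of \<open>dF\<close> beyond \<open>b\<close>, so
  \<open>B b = 0\<close>. The ratio relation carries this to \<open>A b = 0\<close>, and
  \<open>A_ge\<close> then leaves no room for \<open>G b < 1\<close>.\<close>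

lemma F_eq_1_imp:
  assumes "F b = 1" "b > 0" "A b * F b = \<theta> * (B b * G b)"
  shows "G b = 1"
proof -
  have "B b \<le> 0" "0 \<le> B b"
    using relevation_pair.A_le[OF swap \<open>b > 0\<close>] relevation_pair.A_ge[OF swap \<open>b > 0\<close>] assms by auto
  then have "A b = 0" using assms by simp
  then show ?thesis
    using A_ge[OF \<open>b > 0\<close>] relevation_pair.F_le_1[OF swap, of b] by simp
qed

text \<open>An initial interval of the positive axis on which \<open>A\<close> and \<open>B\<close>
  are positive, so that their logarithms can be used.\<close>

definition below_one :: "real set" where
  "below_one = {x. x > 0 \<and> F x < 1 \<and> G x < 1}"

lemma below_one_nonempty: obtains x where "x \<in> below_one"
proof -
  have "\<forall>\<^sub>F x in at_right 0. x \<in> below_one"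
    using F_small relevation_pair.F_small[OF swap] eventually_at_right_less[of 0]
    by eventually_elim (simp add: below_one_def)
  with that show ?thesis
    using eventually_happens by fastforce
qed

lemma below_one_downward: "t \<in> below_one \<Longrightarrow> 0 < s \<Longrightarrow> s \<le> t \<Longrightarrow> s \<in> below_one"
  by (auto simp: below_one_def dest: monoD[OF mono(1)] monoD[OF mono(2)])

lemma const_on_below_one:
  assumes "\<And>y. y \<in> below_one \<Longrightarrow> has_stieltjes_deriv F G f 0 0 y"
    and "s \<in> below_one" "t \<in> below_one"
  shows "f s = f t"
proof -
  have "f s = f t" if "s \<in> below_one" "t \<in> below_one" "s \<le> t" for s t
    using zero_const_on[of s t f] assms(1) below_one_downward[OF that(2)] that
    by (auto simp: below_one_def)
  then show ?thesis
    using assms(2,3) by (metis linear)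
qed

context
  assumes commute: "\<And>x. x > 0 \<Longrightarrow> G x + F x * A x = F x + G x * B x"
begin

text \<open>In the derivative of the commutativity relation, \<open>F dA = - dG\<close> and
  \<open>G dB = - dF\<close> cancel the bare \<open>dG\<close> and \<open>dF\<close>; what remains
  is \<open>A dF - B dG = 0\<close>.\<close>

lemma commute_null:
  assumes "y > 0"
  shows "has_stieltjes_deriv F G (\<lambda>_. 0) (A y) (- B y) y"
proof -
  have "has_stieltjes_deriv F G (\<lambda>t. G t + F t * A t - (F t + G t * B t))
      (0 + (1 * A y + F y * 0) - (1 + (0 * B y + G y * - (1 / G y))))
      (1 + (0 * A y + F y * - (1 / F y)) - (0 + (1 * B y + G y * 0))) y"
    using assms by (intro has_stieltjes_deriv_add has_stieltjes_deriv_diff has_stieltjes_deriv_mult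
        has_stieltjes_deriv_left has_stieltjes_deriv_right cont A_deriv B_deriv A_cont
        relevation_pair.A_cont[OF swap])
  moreover have "\<forall>\<^sub>F t in nhds y. G t + F t * A t - (F t + G t * B t) = 0"
    using eventually_nhds_in_open[OF open_greaterThan, of y 0] assms
    by (auto elim!: eventually_mono simp: commute)
  ultimately have "has_stieltjes_deriv F G (\<lambda>_. 0)
      (0 + (1 * A y + F y * 0) - (1 + (0 * B y + G y * - (1 / G y))))
      (1 + (0 * A y + F y * - (1 / F y)) - (0 + (1 * B y + G y * 0))) y"
    by (rule has_stieltjes_deriv_cong)
  then show ?thesis
    using pos[OF assms] by simp
qed

lemma ratio_const:
  obtains \<theta> where "\<theta> > 0" "\<And>x. x \<in> below_one \<Longrightarrow> A x * F x = \<theta> * (B x * G x)"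
proof -
  define f where "f t = ln (A t) + ln (F t) - (ln (B t) + ln (G t))" for t
  have deriv: "has_stieltjes_deriv F G f 0 0 y" if "y \<in> below_one" for y
  proof -
    have y: "y > 0" "F y > 0" "G y > 0" "A y > 0" "B y > 0"
      using that pos A_pos B_pos by (auto simp: below_one_def)
    \<comment> \<open>Chosen to make the \<open>dF\<close> coefficient of \<open>f\<close> equal to
      \<open>k * A y\<close>; that the \<open>dG\<close> coefficient is then
      \<open>k * - B y\<close> is exactly commutativity at \<open>y\<close>.\<close>
    define k where "k = (1 / F y + 1 / (B y * G y)) / A y"
    have "has_stieltjes_deriv F G f
        (0 / A y + 1 / F y - (- (1 / G y) / B y + 0 / G y))
        (- (1 / F y) / A y + 0 / F y - (0 / B y + 1 / G y)) y"
      unfolding f_def using y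
      by (intro has_stieltjes_deriv_add has_stieltjes_deriv_diff has_stieltjes_deriv_ln
        has_stieltjes_deriv_left has_stieltjes_deriv_right cont A_deriv B_deriv A_cont
        relevation_pair.A_cont[OF swap])
    also have "0 / A y + 1 / F y - (- (1 / G y) / B y + 0 / G y) = k * A y"
      using y by (simp add: k_def field_simps)
    also have "- (1 / F y) / A y + 0 / F y - (0 / B y + 1 / G y) = k * - B y"
    proof -
      have "k * - B y = - ((F y + G y * B y) / (A y * F y * G y))"
        using y by (simp add: k_def field_simps)
      also have "\<dots> = - ((G y + F y * A y) / (A y * F y * G y))"
        using commute y by simp
      finally show ?thesis using y by (simp add: field_simps)
    qed
    finally show ?thesis
      using has_stieltjes_deriv_mod_null commute_null y by blast
  qed
  obtain x0 where x0: "x0 \<in> below_one" by (rule below_one_nonempty)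
  show ?thesis
  proof
    show "exp (f x0) > 0" by simp
  next
    fix x assume "x \<in> below_one"
    then have x: "F x > 0" "G x > 0" "A x > 0" "B x > 0"
      using pos A_pos B_pos by (auto simp: below_one_def)
    have "f x0 = ln (A x * F x / (B x * G x))"
      using const_on_below_one[OF deriv x0 \<open>x \<in> below_one\<close>] x by (simp add: f_def ln_mult ln_div)
    then have "exp (f x0) = A x * F x / (B x * G x)"
      using x by simp
    then show "A x * F x = exp (f x0) * (B x * G x)"
      using x by simp
  qed
qed

text \<open>The filter \<open>L\<close> unifies two cases: \<open>at_top\<close> if neither function
  reaches \<open>1\<close>, and \<open>at_left b\<close> if \<open>b\<close> is the first point
  where one of them does.\<close>

lemma below_one_end:
  assumes ratio: "\<And>x. x \<in> below_one \<Longrightarrow> A x * F x = \<theta> * (B x * G x)" and "\<theta> > 0"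
  obtains L where "L \<noteq> bot" "(F \<longlongrightarrow> 1) L" "(G \<longlongrightarrow> 1) L" "\<forall>\<^sub>F x in L. x \<in> below_one"
    and "\<And>x. x > 0 \<Longrightarrow> x \<notin> below_one \<Longrightarrow> F x = 1 \<and> G x = 1"
proof (cases "\<forall>x>0. x \<in> below_one")
  case True
  with that[of at_top] lim show ?thesis
    by (auto intro: eventually_mono[OF eventually_gt_at_top[of 0]])
next
  case False
  then obtain z where "z > 0" "z \<notin> below_one" by auto
  obtain x0 where x0: "x0 \<in> below_one" by (rule below_one_nonempty)
  then have "x0 > 0" by (simp add: below_one_def)
  \<comment> \<open>Requiring \<open>x0 \<le> x\<close> keeps the infimum of \<open>T\<close> away
    from \<open>0\<close> but loses no positive point outside \<open>below_one\<close>.\<close>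
  define T where "T = {x. x0 \<le> x \<and> (1 \<le> F x \<or> 1 \<le> G x)}"
  have T: "x \<in> T" if "x > 0" "x \<notin> below_one" for x
    using that below_one_downward[OF x0, of x] by (cases x x0 rule: le_cases) (auto simp: T_def below_one_def)
  have "closed T"
    unfolding T_def using cont
    by (intro closed_Collect_conj closed_Collect_disj closed_Collect_le continuous_intros
        continuous_at_imp_continuous_on) auto
  moreover have "T \<noteq> {}" using T \<open>z > 0\<close> \<open>z \<notin> below_one\<close> by auto
  moreover have "bdd_below T" by (auto simp: T_def bdd_below_def)
  ultimately have "Inf T \<in> T" by (rule closed_contains_Inf[rotated 2])
  define b where "b = Inf T"
  have b: "x0 \<le> b" "1 \<le> F b \<or> 1 \<le> G b" "b > 0"
    using \<open>Inf T \<in> T\<close> \<open>x0 > 0\<close> by (auto simp: b_def T_def)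
  have below: "x \<in> below_one" if "0 < x" "x < b" for x
    using that T[of x] cInf_lower[OF _ \<open>bdd_below T\<close>, of x] by (force simp: b_def)
  have ev: "\<forall>\<^sub>F x in at_left b. x \<in> below_one"
    using eventually_at_left_real[OF \<open>b > 0\<close>] by eventually_elim (auto intro: below)
  have "isCont (\<lambda>x. A x * F x - \<theta> * (B x * G x)) b"
    using \<open>b > 0\<close> by (intro continuous_intros cont A_cont relevation_pair.A_cont[OF swap])
  then have "((\<lambda>x. A x * F x - \<theta> * (B x * G x)) \<longlongrightarrow> A b * F b - \<theta> * (B b * G b)) (at_left b)"
    by (simp add: isCont_def filterlim_at_split)
  moreover have "\<forall>\<^sub>F x in at_left b. A x * F x - \<theta> * (B x * G x) = 0"
    using ev by eventually_elim (simp add: ratio)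
  ultimately have "A b * F b - \<theta> * (B b * G b) = 0"
    by (rule tendsto_unique[OF trivial_limit_at_left_real _ tendsto_eventually])
  then have ratio_b: "A b * F b = \<theta> * (B b * G b)" by simp
  then have ratio_b': "B b * G b = 1 / \<theta> * (A b * F b)"
    using \<open>\<theta> > 0\<close> by simp
  have le1: "F x \<le> 1" "G x \<le> 1" for x
    using F_le_1 relevation_pair.F_le_1[OF swap] by auto
  have b1: "F b = 1" "G b = 1"
    using b(2) le1[of b] F_eq_1_imp[OF _ b(3) ratio_b]
      relevation_pair.F_eq_1_imp[OF swap _ b(3) ratio_b'] by auto
  show ?thesis
  proof (rule that[of "at_left b"])
    show "(F \<longlongrightarrow> 1) (at_left b)" "(G \<longlongrightarrow> 1) (at_left b)"
      using cont[of b] b1 by (auto simp: isCont_def filterlim_at_split)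
    fix x assume "x > 0" "x \<notin> below_one"
    with below have "b \<le> x" by force
    then show "F x = 1 \<and> G x = 1"
      using mono b1 le1[of x] by (metis antisym monoD)
  qed (use ev in auto)
qed

lemma commute_imp_powr: "\<exists>\<theta>>0. \<forall>x>0. G x = F x powr \<theta>"
proof -
  obtain \<theta> where "\<theta> > 0" and ratio: "\<And>x. x \<in> below_one \<Longrightarrow> A x * F x = \<theta> * (B x * G x)"
    using ratio_const by blast
  obtain L where L: "L \<noteq> bot" "(F \<longlongrightarrow> 1) L" "(G \<longlongrightarrow> 1) L" "\<forall>\<^sub>F x in L. x \<in> below_one"
    and outside: "\<And>x. x > 0 \<Longrightarrow> x \<notin> below_one \<Longrightarrow> F x = 1 \<and> G x = 1"
    using below_one_end[OF ratio \<open>\<theta> > 0\<close>] by blast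
  define f where "f t = ln (G t) - \<theta> * ln (F t)" for t
  have deriv: "has_stieltjes_deriv F G f 0 0 y" if "y \<in> below_one" for y
  proof -
    have y: "y > 0" "F y > 0" "G y > 0" "A y > 0" "B y > 0"
      using that pos A_pos B_pos by (auto simp: below_one_def)
    have "has_stieltjes_deriv F G f (0 / G y - \<theta> * (1 / F y)) (1 / G y - \<theta> * (0 / F y)) y"
      unfolding f_def using y
      by (intro has_stieltjes_deriv_diff has_stieltjes_deriv_cmult has_stieltjes_deriv_ln
          has_stieltjes_deriv_left has_stieltjes_deriv_right cont)
    \<comment> \<open>The ratio relation gives \<open>\<theta> / F y = A y / (B y * G y)\<close>, so
      the derivative is a multiple of the null pair from \<open>commute_null\<close>.\<close>
    also have "0 / G y - \<theta> * (1 / F y) = - (1 / (B y * G y)) * A y"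
      using ratio[OF that] y by (simp add: field_simps)
    also have "1 / G y - \<theta> * (0 / F y) = - (1 / (B y * G y)) * - B y"
      using y by simp
    finally show ?thesis
      using has_stieltjes_deriv_mod_null commute_null y by blast
  qed
  have "f x = 0" if "x \<in> below_one" for x
  proof -
    \<comment> \<open>The value of the constant \<open>f\<close> is read off along \<open>L\<close>,
      where both logarithms tend to \<open>0\<close>.\<close>
    have "(f \<longlongrightarrow> ln 1 - \<theta> * ln 1) L"
      unfolding f_def by (intro tendsto_intros L) auto
    moreover have "\<forall>\<^sub>F t in L. f t = f x"
      using L(4) by eventually_elim (rule const_on_below_one[OF deriv _ that])
    ultimately have "((\<lambda>_. f x) \<longlongrightarrow> 0) L"
      using tendsto_cong by force
    with L(1) show ?thesis by (simp add: tendsto_const_iff)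
  qed
  then have "G x = F x powr \<theta>" if "x > 0" for x
  proof (cases "x \<in> below_one")
    case True
    then have "ln (G x) = \<theta> * ln (F x)" using \<open>x \<in> below_one \<Longrightarrow> f x = 0\<close> by (simp add: f_def)
    then show ?thesis using pos[OF \<open>x > 0\<close>] by (metis exp_ln less_numeral_extra(3) powr_def)
  qed (use outside that in auto)
  with \<open>\<theta> > 0\<close> show ?thesis by blast
qed

end

end

section \<open>Distributions and their tail integrals fit the abstract setting\<close>

lemma (in real_distribution) interval_measure_cdf: "interval_measure (cdf M) = M"
proof (rule cdf_unique)
  show "real_distribution (interval_measure (cdf M))"
    by (rule real_distribution_interval_measure)
      (auto intro: cdf_nondecreasing cdf_is_right_cont cdf_lim_at_top_prob cdf_lim_at_bot)
  show "cdf (interval_measure (cdf M)) = cdf M"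
    by (rule cdf_interval_measure) (auto intro: cdf_nondecreasing cdf_is_right_cont cdf_lim_at_bot)
qed unfold_locales

lemma set_integral_bounds_finite_measure:
  assumes "finite_measure M" "S \<in> sets M" "set_borel_measurable M S f"
    and "\<And>t. t \<in> S \<Longrightarrow> a \<le> f t" "\<And>t. t \<in> S \<Longrightarrow> f t \<le> (b::real)"
  shows "set_integrable M S f" "measure M S * a \<le> (LINT t:S|M. f t)" "(LINT t:S|M. f t) \<le> measure M S * b"
proof -
  interpret finite_measure M by fact
  have const: "set_integrable M S (\<lambda>_. c)" "(LINT t:S|M. c) = measure M S * c" for c :: real
    using assms(2) by (simp_all add: set_integrable_def set_lebesgue_integral_def integrable_real_indicator less_top[symmetric])
  show f: "set_integrable M S f"
    by (rule set_integrable_bound[OF const(1)[of "max \<bar>a\<bar> \<bar>b\<bar>"] assms(3)])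
      (use assms(4,5) in \<open>force simp: abs_le_iff max_def\<close>)
  show "measure M S * a \<le> (LINT t:S|M. f t)" "(LINT t:S|M. f t) \<le> measure M S * b"
    using set_integral_mono[OF const(1) f assms(4)] set_integral_mono[OF f const(1) assms(5)]
    by (simp_all add: const)
qed

text \<open>On \<open>{s<..t}\<close> the integrand lies between \<open>1 / F t\<close> and
  \<open>1 / F s\<close>, and the measure of this interval is the increment of the CDF.\<close>

lemma (in real_distribution) tail_integral:
  fixes F :: "real \<Rightarrow> real"
  assumes F: "mono F" "\<And>x. x > 0 \<Longrightarrow> F x > 0"
  defines "A x \<equiv> LINT t:{x<..}|M. 1 / F t"
  shows "0 < s \<Longrightarrow> s \<le> t \<Longrightarrow> A s - A t \<le> (cdf M t - cdf M s) / F s"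
    and "0 < s \<Longrightarrow> s \<le> t \<Longrightarrow> (cdf M t - cdf M s) / F t \<le> A s - A t"
    and "(A \<longlongrightarrow> 0) at_top"
proof -
  have meas: "set_borel_measurable M S (\<lambda>t. 1 / F t)" if "S \<in> sets borel" for S
    unfolding set_borel_measurable_def
    using borel_measurable_mono[OF F(1)] that by measurable
  have F_mono: "1 / F v \<le> 1 / F u" if "0 < u" "u \<le> v" for u v
    using F(1) F(2)[of u] that by (simp add: frac_le monoD)
  have F_nonneg: "0 \<le> 1 / F u" if "0 < u" for u
    using F(2)[OF that] by simp
  have tail: "set_integrable M {x<..} (\<lambda>t. 1 / F t)" "0 \<le> A x" "A x \<le> measure M {x<..} / F x" if "x > 0" for x
    using set_integral_bounds_finite_measure[OF finite_measure_axioms _ meas, of "{x<..}" 0 "1 / F x"]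
      F_mono[OF that] F_nonneg that by (auto simp: A_def)
  have "(cdf M t - cdf M s) / F t \<le> A s - A t \<and> A s - A t \<le> (cdf M t - cdf M s) / F s"
    if st: "0 < s" "s \<le> t" for s t
  proof -
    have "{s<..} = {s<..t} \<union> {t<..}" using st by auto
    moreover have "set_integrable M {s<..t} (\<lambda>t. 1 / F t)"
      by (rule set_integrable_subset[OF tail(1)[OF st(1)]]) auto
    ultimately have "A s - A t = (LINT u:{s<..t}|M. 1 / F u)"
      using tail(1)[of t] st by (simp add: A_def set_integral_Un disjoint_iff)
    moreover have "cdf M t - cdf M s = measure M {s<..t}"
      using cdf_diff_eq[of s t] st by (cases "s = t") auto
    moreover have "set_borel_measurable M {s<..t} (\<lambda>t. 1 / F t)" by (rule meas) simp
    note set_integral_bounds_finite_measure(2,3)[OF finite_measure_axioms _ this, of "1 / F t" "1 / F s"]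
    ultimately show ?thesis
      using F_mono st by simp
  qed
  then show "0 < s \<Longrightarrow> s \<le> t \<Longrightarrow> (cdf M t - cdf M s) / F t \<le> A s - A t"
    "0 < s \<Longrightarrow> s \<le> t \<Longrightarrow> A s - A t \<le> (cdf M t - cdf M s) / F s"
    by auto
  \<comment> \<open>For \<open>x \<ge> 1\<close> the integrand is at most \<open>1 / F 1\<close>, so
    the tail mass divided by this fixed constant dominates \<open>A x\<close>.\<close>
  have "((\<lambda>x. (1 - cdf M x) / F 1) \<longlongrightarrow> (1 - 1) / F 1) at_top"
    using F(2)[of 1] by (intro tendsto_intros cdf_lim_at_top_prob) auto
  then have lim: "((\<lambda>x. (1 - cdf M x) / F 1) \<longlongrightarrow> 0) at_top" by simp
  show "(A \<longlongrightarrow> 0) at_top"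
  proof (rule tendsto_sandwich[OF _ _ tendsto_const lim])
    show "\<forall>\<^sub>F x in at_top. 0 \<le> A x"
      using eventually_gt_at_top[of 0] by eventually_elim (rule tail)
    show "\<forall>\<^sub>F x in at_top. A x \<le> (1 - cdf M x) / F 1"
      using eventually_ge_at_top[of 1]
    proof eventually_elim
      case (elim x)
      have "- {..x} = {x<..}" by auto
      then have "measure M {x<..} = 1 - cdf M x"
        using prob_compl[of "{..x}"] by (simp add: cdf_def Compl_eq_Diff_UNIV)
      moreover have "measure M {x<..} * (1 / F x) \<le> measure M {x<..} * (1 / F 1)"
        by (rule mult_left_mono[OF F_mono]) (use elim in auto)
      ultimately show ?case using tail(3)[of x] elim by simp
    qed
  qed
qed

lemma distr_cdf_facts:
  fixes X :: "'a \<Rightarrow> real"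
  assumes "prob_space M" "X \<in> borel_measurable M"
    and ac: "absolutely_continuous lborel (distr M borel X)"
    and nonneg: "AE \<omega> in M. 0 \<le> X \<omega>"
  defines "F \<equiv> cdf (distr M borel X)"
  shows "real_distribution (distr M borel X)" "mono F" "isCont F x" "F 0 = 0" "(F \<longlongrightarrow> 1) at_top"
proof -
  interpret M: prob_space M by fact
  interpret real_distribution "distr M borel X"
    using assms(2) by (rule M.real_distribution_distr)
  show "real_distribution (distr M borel X)" by unfold_locales
  show "mono F" unfolding F_def by (auto simp: mono_def intro: cdf_nondecreasing)
  show "(F \<longlongrightarrow> 1) at_top" unfolding F_def by (rule cdf_lim_at_top_prob)
  \<comment> \<open>Points are Lebesgue null, so absolute continuity excludes atoms; this yields
    both continuity of \<open>F\<close> and, with nonnegativity, \<open>F 0 = 0\<close>.\<close>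
  have atom: "measure (distr M borel X) {y} = 0" for y
    using ac unfolding absolutely_continuous_def
    by (meson finite_imp_null_set_lborel finite.intros null_setsD1 measure_eq_0_null_sets subsetD)
  then show "isCont F x" unfolding F_def by (simp add: isCont_cdf)
  have "M.prob (X -` {..0} \<inter> space M) = M.prob (X -` {0} \<inter> space M)"
    using nonneg assms(2) by (intro M.finite_measure_eq_AE) (auto elim!: eventually_mono)
  then show "F 0 = 0"
    using atom[of 0] assms(2) by (simp add: F_def cdf_def measure_distr)
qed

theorem theorem1:
  fixes M :: "'a measure" and X Y :: "'a \<Rightarrow> real" and F G :: "real \<Rightarrow> real"
  assumes "prob_space M"
    and "X \<in> borel_measurable M" and "Y \<in> borel_measurable M"
    and "prob_space.indep_var M borel X borel Y"
    and "absolutely_continuous lborel (distr M borel X)"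
    and "absolutely_continuous lborel (distr M borel Y)"
    and "AE \<omega> in M. 0 \<le> X \<omega>" and "AE \<omega> in M. 0 \<le> Y \<omega>"
    and "F = cdf (distr M borel X)" and "G = cdf (distr M borel Y)"
    and "\<And>t. t > 0 \<Longrightarrow> F t > 0" and "\<And>t. t > 0 \<Longrightarrow> G t > 0"
  shows "(\<forall>x>0. reversed_relevation G F x = reversed_relevation F G x) \<longleftrightarrow>
         (\<exists>\<theta>>0. \<forall>x>0. G x = F x powr \<theta>)"
proof -
  note X = distr_cdf_facts[OF assms(1,2,5,7), folded assms(9)]
  note Y = distr_cdf_facts[OF assms(1,3,6,8), folded assms(10)]
  have imX: "interval_measure F = distr M borel X"
    using real_distribution.interval_measure_cdf[OF X(1)] by (simp add: assms(9))
  have imY: "interval_measure G = distr M borel Y"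
    using real_distribution.interval_measure_cdf[OF Y(1)] by (simp add: assms(10))
  note A = real_distribution.tail_integral[OF Y(1) X(2) assms(11), folded assms(10), folded imY]
  note B = real_distribution.tail_integral[OF X(1) Y(2) assms(12), folded assms(9), folded imX]
  interpret relevation_pair F G "\<lambda>x. LINT t:{x<..}|interval_measure G. 1 / F t"
      "\<lambda>x. LINT t:{x<..}|interval_measure F. 1 / G t"
    by unfold_locales ((fact X Y assms(11,12) | (rule A B; assumption))+)
  show ?thesis
    unfolding reversed_relevation_def
    using commute_imp_powr powr_imp_commute by blast
qed

end
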